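(* For all $x,y\in\mathbb{B}^n$, with $t=\max\{|x|,|y|\}$, $$\log\frac{(1-t^2)\sqrt{|x-y|^2+1-t^2}}{\left(\sqrt{|x-y|^2+1-t^2}-|x-y|\right)\left(1-t^2-|x-y|\left(\sqrt{|x-y|^2+1-t^2}-|x-y|\right)\right)}\le h_{\mathbb{B}^n}(x,y)$$ and $$h_{\mathbb{B}^n}(x,y)\le\max\left\{\log\frac{(1+t)(1-t+|x-y|)}{(1-t)(1+t-|x-y|)},\;2\log\left(\frac{\sqrt{4(1-t^2)+|x-y|^2}+|x-y|}{\sqrt{4(1-t^2)+|x-y|^2}-|x-y|}\right)\right\}.$$
   Context: Let $n\ge 2$ and let $\mathbb{B}^n$ be the open Euclidean unit ball in $\mathbb{R}^n$, with boundary sphere $S^{n-1}$. For distinct $x,y\in\mathbb{R}^n$, $L(x,y)$ denotes the Euclidean line through $x$ and $y$. Hilbert metric: for distinct $x,y\in\mathbb{B}^n$, $$h_{\mathbb{B}^n}(x,y)=\log\frac{|u-y|\,|x-v|}{|u-x|\,|y-v|},$$ where $u,v$ are the two points of $L(x,y)\cap S^{n-1}$, ordered so that $|u-x|<|u-y|$; and $h_{\mathbb{B}^n}(x,x)=0$. The logarithm is natural. *)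

theory Defs
  imports "HOL-Analysis.Analysis"
begin

definition euclid_line :: "real ^ 'n \<Rightarrow> real ^ 'n \<Rightarrow> (real ^ 'n) set" where
  "euclid_line x y = affine hull {x, y}"

(* Only meaningful for distinct x, y in the open unit ball; there the pair is unique,
   the strict inequality fixing the order of the two intersection points. *)
definition chord_ends :: "real ^ 'n \<Rightarrow> real ^ 'n \<Rightarrow> (real ^ 'n) \<times> (real ^ 'n)" where
  "chord_ends x y =
     (THE (u, v). u \<noteq> v \<and> euclid_line x y \<inter> sphere 0 1 = {u, v} \<and> norm (u - x) < norm (u - y))"

definition hilbert_ball :: "real ^ 'n \<Rightarrow> real ^ 'n \<Rightarrow> real" where
  "hilbert_ball x y =
     (if x = y then 0
      else let (u, v) = chord_ends x y
           in ln ((norm (u - y) * norm (x - v)) / (norm (u - x) * norm (y - v))))"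

end

theory Submission
  imports Defs
begin

text \<open>
  The key is that, for \<open>x \<noteq> y\<close>, once \<open>d = |x - y|\<close> and \<open>t = max |x| |y|\<close> are given, the Hilbert distance depends
  on a single further parameter. Let \<open>s = 1 - t\<^sup>2\<close>, put a coordinate on the chord through \<open>x\<close> and
  \<open>y\<close> with its origin at the midpoint of the chord, and let \<open>c\<close> be the coordinate of the point of
  larger norm, the chord being directed so that this point comes last. The chord then has
  half-length \<open>sqrt (s + c\<^sup>2)\<close>, and the cross ratio gives
  \<open>h = 2 artanh R(c)\<close> with \<open>R(c) = d sqrt (s + c\<^sup>2) / (s + c d)\<close>
  (lemma \<open>hilbert_ball_eq_artanh_klein_ratio\<close>). Here \<open>d / 2 \<le> c \<le> t\<close>: the left end is the
  case \<open>|x| = |y|\<close>, the right end the case of a diameter.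

  On \<open>c \<ge> 0\<close> the function \<open>R\<close> decreases up to \<open>c = d\<close> and increases afterwards. Its minimum
  \<open>R(d) = d / sqrt (s + d\<^sup>2)\<close>, where the point nearer to the origin is the midpoint of the
  chord, is the lower bound; that it is a minimum is the Cauchy-Schwarz inequality for the plane
  vectors \<open>(sqrt s, c)\<close> and \<open>(sqrt s, d)\<close>. The maximum over \<open>[d / 2, t]\<close> is attained at an end
  point, and \<open>R(t)\<close> and \<open>R(d / 2)\<close> give the two terms of the upper bound.
\<close>

section \<open>The Hilbert distance along a chord\<close>

lemma ln_ratio_eq_artanh:
  fixes w z :: real
  assumes "\<bar>z\<bar> < w"
  shows "ln ((w + z) / (w - z)) = 2 * artanh (z / w)"
proof -
  have "(w + z) / (w - z) = (1 + z / w) / (1 - z / w)"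
    using assms by (simp add: divide_simps)
  then show ?thesis
    by (simp add: artanh_def)
qed

lemma artanh_mono:
  fixes r r' :: real
  assumes "-1 < r" "r \<le> r'" "r' < 1"
  shows "artanh r \<le> artanh r'"
proof -
  have "(1 + r) / (1 - r) \<le> (1 + r') / (1 - r')"
    using assms by (intro frac_le) auto
  moreover have "0 < (1 + r) / (1 - r)"
    using assms by simp
  ultimately show ?thesis
    by (simp add: artanh_def)
qed

lemma norm_add_scaleR_unit:
  fixes x e :: "'a::real_inner"
  assumes "norm e = 1"
  shows "(norm (x + r *\<^sub>R e))\<^sup>2 = (norm x)\<^sup>2 - (x \<bullet> e)\<^sup>2 + (x \<bullet> e + r)\<^sup>2"
proof -
  have "e \<bullet> e = 1"
    using assms by (simp add: norm_eq_1)
  then show ?thesis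
    by (simp only: power2_norm_eq_inner)
      (simp add: inner_add_left inner_add_right inner_commute power2_eq_square algebra_simps)
qed

text \<open>Completing the square shows that \<open>x + r e\<close> has norm 1 iff \<open>|x \<bullet> e + r| = L\<close>, so \<open>L\<close> is the
  half-length of the chord. Both \<open>x\<close> and \<open>x + d e\<close> lie between the two solutions, and therefore
  only one labelling of them puts the first end nearer to \<open>x\<close>.\<close>

lemma chord_ends_eq:
  fixes x e :: "real ^ 'n" and d :: real
  defines "L \<equiv> sqrt (1 - (norm x)\<^sup>2 + (x \<bullet> e)\<^sup>2)"
  assumes e: "norm e = 1" and d: "d > 0"
    and x: "\<bar>x \<bullet> e\<bar> < L" and y: "\<bar>x \<bullet> e + d\<bar> < L"
  shows "chord_ends x (x + d *\<^sub>R e) = (x + (- L - x \<bullet> e) *\<^sub>R e, x + (L - x \<bullet> e) *\<^sub>R e)"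
proof -
  define a where "a = x \<bullet> e"
  define P where "P r = x + r *\<^sub>R e" for r
  have L: "L > 0"
    using x by linarith
  then have L2: "L\<^sup>2 = 1 - (norm x)\<^sup>2 + a\<^sup>2"
    unfolding L_def a_def by (metis less_eq_real_def real_sqrt_gt_0_iff real_sqrt_pow2)
  have e0: "e \<noteq> 0"
    using e by auto
  have dist_P: "norm (P r - P r') = \<bar>r - r'\<bar>" for r r'
  proof -
    have "P r - P r' = (r - r') *\<^sub>R e"
      by (simp add: P_def algebra_simps)
    then show ?thesis
      using e by simp
  qed
  have line: "euclid_line x (x + d *\<^sub>R e) = range P"
  proof -
    have "euclid_line x (x + d *\<^sub>R e) = range (\<lambda>r. P (r * d))"
      unfolding euclid_line_def affine_hull_2_alt by (simp add: P_def)
    also have "\<dots> = range P"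
    proof -
      have "P r = P (r / d * d)" for r
        using d by simp
      then show ?thesis
        by blast
    qed
    finally show ?thesis .
  qed
  have on_sphere: "norm (P r) = 1 \<longleftrightarrow> r = - L - a \<or> r = L - a" for r
  proof -
    have "norm (P r) = 1 \<longleftrightarrow> (norm (P r))\<^sup>2 = 1"
      using power2_eq_iff_nonneg[of "norm (P r)" 1] by simp
    also have "\<dots> \<longleftrightarrow> (a + r)\<^sup>2 = L\<^sup>2"
      using norm_add_scaleR_unit[OF e, of x r] L2 unfolding P_def a_def by linarith
    also have "\<dots> \<longleftrightarrow> r = - L - a \<or> r = L - a"
      by (auto simp: power2_eq_iff)
    finally show ?thesis .
  qed
  have ends: "euclid_line x (x + d *\<^sub>R e) \<inter> sphere 0 1 = {P (- L - a), P (L - a)}"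
    unfolding line by (auto simp: on_sphere)
  have xP: "x = P 0"
    by (simp add: P_def)
  have near: "norm (P (- L - a) - x) < norm (P (- L - a) - P d)"
    using x y d dist_P[of _ 0] by (simp add: xP[symmetric] dist_P a_def)
  have far: "\<not> norm (P (L - a) - x) < norm (P (L - a) - P d)"
    using x y d dist_P[of _ 0] by (simp add: xP[symmetric] dist_P a_def)
  have neq: "P (- L - a) \<noteq> P (L - a)"
    using dist_P[of "- L - a" "L - a"] L by auto
  show ?thesis
    unfolding chord_ends_def ends
    unfolding a_def[symmetric] P_def[symmetric]
    using near far neq by (intro the_equality) (auto simp: doubleton_eq_iff)
qed

lemma hilbert_ball_along_line:
  fixes x e :: "real ^ 'n" and d :: real
  defines "a \<equiv> x \<bullet> e" and "L \<equiv> sqrt (1 - (norm x)\<^sup>2 + (x \<bullet> e)\<^sup>2)"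
  assumes e: "norm e = 1" and d: "d > 0"
    and x: "norm x < 1" and y: "norm (x + d *\<^sub>R e) < 1"
  shows "L * d < L\<^sup>2 - a * (a + d)"
    and "hilbert_ball x (x + d *\<^sub>R e) = 2 * artanh (L * d / (L\<^sup>2 - a * (a + d)))"
proof -
  have x1: "(norm x)\<^sup>2 < 1" and y1: "(norm (x + d *\<^sub>R e))\<^sup>2 < 1"
    using x y by (simp_all add: abs_square_less_1)
  have aL: "\<bar>a\<bar> < L"
    using x1 unfolding L_def a_def by (intro real_less_rsqrt) simp
  have bL: "\<bar>a + d\<bar> < L"
    using y1 norm_add_scaleR_unit[OF e, of x d] unfolding L_def a_def
    by (intro real_less_rsqrt) simp
  have "0 < (L + a) * (L - (a + d))"
    using aL bL by (intro mult_pos_pos) linarith+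
  also have eq1: "\<dots> = L\<^sup>2 - a * (a + d) - L * d"
    by (simp add: algebra_simps power2_eq_square)
  finally show less: "L * d < L\<^sup>2 - a * (a + d)"
    by simp
  have eq2: "(L + (a + d)) * (L - a) = L\<^sup>2 - a * (a + d) + L * d"
    by (simp add: algebra_simps power2_eq_square)
  have ends: "chord_ends x (x + d *\<^sub>R e) = (x + (- L - a) *\<^sub>R e, x + (L - a) *\<^sub>R e)"
    using chord_ends_eq[OF e d] aL bL unfolding a_def L_def by blast
  have dist: "norm (x + r *\<^sub>R e - (x + r' *\<^sub>R e)) = \<bar>r - r'\<bar>" for r r'
  proof -
    have "x + r *\<^sub>R e - (x + r' *\<^sub>R e) = (r - r') *\<^sub>R e"
      by (simp add: algebra_simps)
    then show ?thesis
      using e by simp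
  qed
  have norms: "norm (x + (- L - a) *\<^sub>R e - (x + d *\<^sub>R e)) = L + (a + d)"
    "norm (x - (x + (L - a) *\<^sub>R e)) = L - a"
    "norm (x + (- L - a) *\<^sub>R e - x) = L + a"
    "norm (x + d *\<^sub>R e - (x + (L - a) *\<^sub>R e)) = L - (a + d)"
    using dist[of "- L - a" d] dist[of 0 "L - a"] dist[of "- L - a" 0] dist[of d "L - a"] aL bL e
    by simp_all
  have "(x = x + d *\<^sub>R e) = False"
    using e d by auto
  then have "hilbert_ball x (x + d *\<^sub>R e)
      = ln (((L + (a + d)) * (L - a)) / ((L + a) * (L - (a + d))))"
    by (simp only: hilbert_ball_def ends Let_def prod.case if_False norms)
  also have "\<dots> = 2 * artanh (L * d / (L\<^sup>2 - a * (a + d)))"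
    unfolding eq1 eq2 using less aL d by (intro ln_ratio_eq_artanh) simp
  finally show "hilbert_ball x (x + d *\<^sub>R e) = 2 * artanh (L * d / (L\<^sup>2 - a * (a + d)))" .
qed

section \<open>The one-parameter family\<close>

text \<open>The hyperbolic tangent of half the Hilbert distance, as explained above.\<close>

definition klein_ratio :: "real \<Rightarrow> real \<Rightarrow> real \<Rightarrow> real" where
  "klein_ratio s d c = d * sqrt (s + c\<^sup>2) / (s + c * d)"

text \<open>If \<open>y\<close> is the point of larger norm, then \<open>c\<close> is its coordinate in the direction \<open>e\<close> from \<open>x\<close>
  to \<open>y\<close>; otherwise the chord is read backwards and \<open>c = - (x \<bullet> e)\<close>. In both cases \<open>d / 2 \<le> c\<close>
  says that the other end, at \<open>c - d\<close>, is at most as far from the midpoint of the chord.\<close>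

lemma hilbert_ball_eq_artanh_klein_ratio:
  fixes x y :: "real ^ 'n"
  assumes x: "norm x < 1" and y: "norm y < 1" and neq: "x \<noteq> y"
  defines "d \<equiv> norm (x - y)" and "t \<equiv> max (norm x) (norm y)"
  obtains c where "d / 2 \<le> c" "c \<le> t" "klein_ratio (1 - t\<^sup>2) d c < 1"
    "hilbert_ball x y = 2 * artanh (klein_ratio (1 - t\<^sup>2) d c)"
proof -
  define e where "e = (1 / d) *\<^sub>R (y - x)"
  define a where "a = x \<bullet> e"
  define L where "L = sqrt (1 - (norm x)\<^sup>2 + a\<^sup>2)"
  define R where "R = L * d / (L\<^sup>2 - a * (a + d))"
  have d: "d > 0"
    using neq by (simp add: d_def)
  have e: "norm e = 1"
    using d by (simp add: e_def d_def norm_minus_commute)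
  have y_eq: "y = x + d *\<^sub>R e"
    using d by (simp add: e_def)
  have x1: "(norm x)\<^sup>2 < 1" and y1: "(norm y)\<^sup>2 < 1"
    using x y by (simp_all add: abs_square_less_1)
  have L2: "L\<^sup>2 = 1 - (norm x)\<^sup>2 + a\<^sup>2"
    unfolding L_def using x1 by (intro real_sqrt_pow2) (simp add: add_nonneg_nonneg)
  have yn: "(norm y)\<^sup>2 = (norm x)\<^sup>2 - a\<^sup>2 + (a + d)\<^sup>2"
    using norm_add_scaleR_unit[OF e, of x d] unfolding y_eq a_def .
  have Rlt: "L * d < L\<^sup>2 - a * (a + d)" and h: "hilbert_ball x y = 2 * artanh R"
    using hilbert_ball_along_line[OF e d x] y unfolding R_def L_def a_def y_eq by blast+
  have "0 \<le> L"
    unfolding L_def using x1 by simp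
  then have "0 < L\<^sup>2 - a * (a + d)"
    using Rlt d by (smt (verit) mult_nonneg_nonneg)
  then have R1: "R < 1"
    unfolding R_def using Rlt by simp
  show thesis
  proof (cases "norm x \<le> norm y")
    case True
    then have t: "t = norm y"
      by (simp add: t_def)
    have "a\<^sup>2 \<le> (a + d)\<^sup>2"
      using yn power_mono[OF True norm_ge_zero, of 2] by linarith
    then have "0 \<le> d * (2 * a + d)"
      by (simp add: power2_eq_square algebra_simps)
    then have lo: "d / 2 \<le> a + d"
      using d by (simp add: zero_le_mult_iff)
    have "a + d = y \<bullet> e"
      using e unfolding y_eq a_def by (simp add: inner_add_left norm_eq_1)
    then have hi: "a + d \<le> t"
      using norm_cauchy_schwarz[of y e] e t by simp
    have "R = klein_ratio (1 - t\<^sup>2) d (a + d)"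
    proof -
      have "sqrt (1 - t\<^sup>2 + (a + d)\<^sup>2) = L"
        unfolding L_def using yn t by simp
      moreover have "1 - t\<^sup>2 + (a + d) * d = L\<^sup>2 - a * (a + d)"
        using yn L2 t by (simp add: power2_eq_square algebra_simps)
      ultimately show ?thesis
        by (simp add: R_def klein_ratio_def mult.commute)
    qed
    then show thesis
      using that lo hi R1 h by metis
  next
    case False
    then have t: "t = norm x"
      by (simp add: t_def)
    have "(a + d)\<^sup>2 \<le> a\<^sup>2"
      using yn power_mono[of "norm y" "norm x" 2] False by fastforce
    then have "d * (2 * a + d) \<le> 0"
      by (simp add: power2_eq_square algebra_simps)
    then have lo: "d / 2 \<le> - a"
      using d by (simp add: mult_le_0_iff)
    have hi: "- a \<le> t"
      using Cauchy_Schwarz_ineq2[of x e] e t by (simp add: a_def)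
    have "R = klein_ratio (1 - t\<^sup>2) d (- a)"
    proof -
      have "sqrt (1 - t\<^sup>2 + (- a)\<^sup>2) = L"
        unfolding L_def using t by simp
      moreover have "1 - t\<^sup>2 + (- a) * d = L\<^sup>2 - a * (a + d)"
        using L2 t by (simp add: power2_eq_square algebra_simps)
      ultimately show ?thesis
        by (simp add: R_def klein_ratio_def mult.commute)
    qed
    then show thesis
      using that lo hi R1 h by metis
  qed
qed

text \<open>The Cauchy-Schwarz inequality: \<open>(s + c\<^sup>2) (s + d\<^sup>2) - (s + c d)\<^sup>2 = s (c - d)\<^sup>2\<close>.\<close>

lemma klein_ratio_lower_bound:
  assumes "s > 0" "c \<ge> 0" "d \<ge> 0"
  shows "d / sqrt (d\<^sup>2 + s) \<le> klein_ratio s d c"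
proof -
  have pos: "0 < s + c * d" "0 < sqrt (d\<^sup>2 + s)"
    using assms by (simp_all add: add_pos_nonneg add_nonneg_pos)
  have "(s + c\<^sup>2) * (d\<^sup>2 + s) - (s + c * d)\<^sup>2 = s * (c - d)\<^sup>2"
    by (simp add: power2_eq_square algebra_simps)
  moreover have "0 \<le> s * (c - d)\<^sup>2"
    using assms by simp
  ultimately have "(s + c * d)\<^sup>2 \<le> (s + c\<^sup>2) * (d\<^sup>2 + s)"
    by linarith
  then have "s + c * d \<le> sqrt (s + c\<^sup>2) * sqrt (d\<^sup>2 + s)"
    unfolding real_sqrt_mult[symmetric] by (rule real_le_rsqrt)
  then have "1 / sqrt (d\<^sup>2 + s) \<le> sqrt (s + c\<^sup>2) / (s + c * d)"
    using pos by (simp add: field_simps)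
  then show ?thesis
    using mult_left_mono[of _ _ d] assms by (fastforce simp: klein_ratio_def)
qed

lemma klein_ratio_leI:
  assumes "s > 0" "c \<ge> 0" "c' \<ge> 0" "d \<ge> 0"
    and "(s + c\<^sup>2) * (s + c' * d)\<^sup>2 \<le> (s + c'\<^sup>2) * (s + c * d)\<^sup>2"
  shows "klein_ratio s d c \<le> klein_ratio s d c'"
proof -
  have pos: "0 < s + c * d" "0 < s + c' * d"
    using assms by (simp_all add: add_pos_nonneg)
  have "sqrt (s + c\<^sup>2) * (s + c' * d) \<le> sqrt (s + c'\<^sup>2) * (s + c * d)"
    using real_sqrt_le_mono[OF assms(5)] pos by (simp add: real_sqrt_mult)
  then have "sqrt (s + c\<^sup>2) / (s + c * d) \<le> sqrt (s + c'\<^sup>2) / (s + c' * d)"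
    using pos by (simp add: field_simps)
  then show ?thesis
    using mult_left_mono[of _ _ d] assms(4) by (fastforce simp: klein_ratio_def)
qed

text \<open>Let \<open>s, d > 0\<close> and \<open>c, c' \<ge> 0\<close>. The derivative of \<open>klein_ratio s d\<close> at \<open>c\<close> has the sign of \<open>c - d\<close>. The factorization below is
  the corresponding statement for differences; its bracket has the sign of \<open>d - c\<close> when \<open>c\<close> and
  \<open>c'\<close> lie on the same side of \<open>d\<close>.\<close>

lemma klein_ratio_difference:
  fixes s c c' d :: real
  shows "(s + c\<^sup>2) * (s + c' * d)\<^sup>2 - (s + c'\<^sup>2) * (s + c * d)\<^sup>2
    = s * (c' - c) * (s * ((d - c) + (d - c')) + d * (c * (d - c') + c' * (d - c)))"
  by (simp add: power2_eq_square algebra_simps)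

lemma klein_ratio_antimono:
  assumes "s > 0" "0 \<le> c" "c \<le> c'" "c' \<le> d"
  shows "klein_ratio s d c' \<le> klein_ratio s d c"
proof -
  have "0 \<le> s * (c' - c) * (s * ((d - c) + (d - c')) + d * (c * (d - c') + c' * (d - c)))"
    using assms by (intro mult_nonneg_nonneg add_nonneg_nonneg) auto
  also note klein_ratio_difference[symmetric]
  finally show ?thesis
    using assms by (intro klein_ratio_leI) auto
qed

lemma klein_ratio_mono:
  assumes "s > 0" "0 \<le> d" "d \<le> c" "c \<le> c'"
  shows "klein_ratio s d c \<le> klein_ratio s d c'"
proof -
  have "0 \<le> s * (c' - c) * (s * ((c - d) + (c' - d)) + d * (c * (c' - d) + c' * (c - d)))"
    using assms by (intro mult_nonneg_nonneg add_nonneg_nonneg) auto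
  also have "\<dots> = s * (c - c') * (s * ((d - c') + (d - c)) + d * (c' * (d - c) + c * (d - c')))"
    by (simp add: algebra_simps)
  also note klein_ratio_difference[symmetric]
  finally show ?thesis
    using assms by (intro klein_ratio_leI) auto
qed

section \<open>The three extremal values\<close>

lemma artanh_minimum:
  fixes s d :: real
  assumes s: "s > 0" and d: "d \<ge> 0"
  defines "q \<equiv> sqrt (d\<^sup>2 + s)"
  shows "ln ((s * q) / ((q - d) * (s - d * (q - d)))) = 2 * artanh (d / q)"
proof -
  have "d < q"
    unfolding q_def using s by (intro real_less_rsqrt) simp
  have "q\<^sup>2 = d\<^sup>2 + s"
    unfolding q_def using s by (intro real_sqrt_pow2) simp
  then have s_eq: "s = (q + d) * (q - d)"
    by (simp add: power2_eq_square algebra_simps)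
  have "s - d * (q - d) = q * (q - d)"
    unfolding s_eq by (simp add: algebra_simps)
  then have "(s * q) / ((q - d) * (s - d * (q - d))) = (q + d) / (q - d)"
    using \<open>d < q\<close> d by (simp add: s_eq)
  then show ?thesis
    using ln_ratio_eq_artanh[of d q] \<open>d < q\<close> d by simp
qed

lemma artanh_klein_ratio_diameter:
  fixes t d :: real
  assumes "0 \<le> t" "t < 1" "0 \<le> d" "d \<le> 2 * t"
  shows "klein_ratio (1 - t\<^sup>2) d t < 1"
    and "ln (((1 + t) * (1 - t + d)) / ((1 - t) * (1 + t - d)))
      = 2 * artanh (klein_ratio (1 - t\<^sup>2) d t)"
proof -
  define w where "w = 1 - t\<^sup>2 + t * d"
  have "0 < (1 - t) * (1 + t - d)"
    using assms by (intro mult_pos_pos) auto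
  also have eq1: "\<dots> = w - d"
    by (simp add: w_def power2_eq_square algebra_simps)
  finally have less: "d < w"
    by simp
  have eq2: "(1 + t) * (1 - t + d) = w + d"
    by (simp add: w_def power2_eq_square algebra_simps)
  have k: "klein_ratio (1 - t\<^sup>2) d t = d / w"
    by (simp add: klein_ratio_def w_def)
  show "klein_ratio (1 - t\<^sup>2) d t < 1"
    using less assms by (simp add: k)
  show "ln (((1 + t) * (1 - t + d)) / ((1 - t) * (1 + t - d)))
      = 2 * artanh (klein_ratio (1 - t\<^sup>2) d t)"
    unfolding eq1 eq2 k using less assms by (intro ln_ratio_eq_artanh) simp
qed

text \<open>With \<open>W\<close> the length of the chord, the symmetric case is the addition formula
  \<open>2 artanh (d / W) = artanh (2 d W / (W\<^sup>2 + d\<^sup>2))\<close>: the midpoint of the chord halves the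
  distance.\<close>

lemma artanh_klein_ratio_symmetric:
  fixes s d :: real
  assumes s: "s > 0" and d: "d \<ge> 0"
  defines "W \<equiv> sqrt (4 * s + d\<^sup>2)"
  shows "klein_ratio s d (d / 2) < 1"
    and "2 * ln ((W + d) / (W - d)) = 2 * artanh (klein_ratio s d (d / 2))"
proof -
  have dW: "d < W"
    unfolding W_def using s by (intro real_less_rsqrt) simp
  have W2: "W\<^sup>2 = 4 * s + d\<^sup>2"
    unfolding W_def using s by (intro real_sqrt_pow2) simp
  have "s + (d / 2)\<^sup>2 = (W / 2)\<^sup>2"
    using W2 by (simp add: power_divide)
  then have sq: "sqrt (s + (d / 2)\<^sup>2) = W / 2"
    using dW d by simp
  have den: "s + d / 2 * d = (W\<^sup>2 + d\<^sup>2) / 4"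
    using W2 by (simp add: power2_eq_square)
  have k: "klein_ratio s d (d / 2) = 2 * d * W / (W\<^sup>2 + d\<^sup>2)"
    unfolding klein_ratio_def sq den by simp
  have "0 < (W - d)\<^sup>2"
    using dW by simp
  also have eq1: "\<dots> = W\<^sup>2 + d\<^sup>2 - 2 * d * W"
    by (simp add: power2_eq_square algebra_simps)
  finally have less: "2 * d * W < W\<^sup>2 + d\<^sup>2"
    by simp
  have pos: "0 \<le> 2 * d * W"
    using dW d by simp
  have eq2: "(W + d)\<^sup>2 = W\<^sup>2 + d\<^sup>2 + 2 * d * W"
    by (simp add: power2_eq_square algebra_simps)
  show "klein_ratio s d (d / 2) < 1"
    unfolding k using less le_less_trans[OF pos less] by (simp only: divide_less_eq_1_pos)
  have "2 * ln ((W + d) / (W - d)) = ln (((W + d) / (W - d))\<^sup>2)"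
    using dW d by (simp add: ln_realpow)
  also have "\<dots> = ln ((W\<^sup>2 + d\<^sup>2 + 2 * d * W) / (W\<^sup>2 + d\<^sup>2 - 2 * d * W))"
    by (simp only: power_divide eq1 eq2)
  also have "\<dots> = 2 * artanh (klein_ratio s d (d / 2))"
    unfolding k using less pos by (intro ln_ratio_eq_artanh) simp
  finally show "2 * ln ((W + d) / (W - d)) = 2 * artanh (klein_ratio s d (d / 2))" .
qed

section \<open>The two-sided estimate\<close>

theorem theorem4p3:
  fixes x y :: "real ^ 'n" and t :: real
  assumes "CARD('n) \<ge> 2"
    and "x \<in> ball 0 1" and "y \<in> ball 0 1"
    and "t = max (norm x) (norm y)"
  shows "ln (((1 - t\<^sup>2) * sqrt ((norm (x - y))\<^sup>2 + 1 - t\<^sup>2)) /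
             ((sqrt ((norm (x - y))\<^sup>2 + 1 - t\<^sup>2) - norm (x - y)) *
              (1 - t\<^sup>2 - norm (x - y) * (sqrt ((norm (x - y))\<^sup>2 + 1 - t\<^sup>2) - norm (x - y)))))
           \<le> hilbert_ball x y
       \<and> hilbert_ball x y
           \<le> max (ln (((1 + t) * (1 - t + norm (x - y))) / ((1 - t) * (1 + t - norm (x - y)))))
                 (2 * ln ((sqrt (4 * (1 - t\<^sup>2) + (norm (x - y))\<^sup>2) + norm (x - y)) /
                          (sqrt (4 * (1 - t\<^sup>2) + (norm (x - y))\<^sup>2) - norm (x - y))))"
proof -
  define d where "d = norm (x - y)"
  define s where "s = 1 - t\<^sup>2"
  have x: "norm x < 1" and y: "norm y < 1"
    using assms(2,3) by auto
  have t: "0 \<le> t" "t < 1"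
    using x y assms(4) by (auto simp: le_max_iff_disj)
  have s: "s > 0"
    using t by (simp add: s_def abs_square_less_1)
  have d: "0 \<le> d"
    by (simp add: d_def)
  have d2t: "d \<le> 2 * t"
    using norm_triangle_ineq4[of x y] assms(4) by (simp add: d_def)
  have "2 * artanh (d / sqrt (d\<^sup>2 + s)) \<le> hilbert_ball x y
      \<and> hilbert_ball x y
        \<le> max (2 * artanh (klein_ratio s d t)) (2 * artanh (klein_ratio s d (d / 2)))"
  proof (cases "x = y")
    case True
    then show ?thesis
      by (simp add: d_def hilbert_ball_def klein_ratio_def)
  next
    case False
    obtain c where c: "d / 2 \<le> c" "c \<le> t" "klein_ratio s d c < 1"
      and h: "hilbert_ball x y = 2 * artanh (klein_ratio s d c)"
      using hilbert_ball_eq_artanh_klein_ratio[OF x y False]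
      unfolding d_def s_def assms(4) by blast
    have c0: "0 \<le> c"
      using c(1) d by simp
    have "-1 < d / sqrt (d\<^sup>2 + s)"
      using d s by (smt (verit) divide_nonneg_nonneg real_sqrt_ge_zero zero_le_power2)
    then have lower: "artanh (d / sqrt (d\<^sup>2 + s)) \<le> artanh (klein_ratio s d c)"
      using klein_ratio_lower_bound[OF s c0 d] c(3) by (intro artanh_mono)
    have "0 \<le> klein_ratio s d c"
      using s d c0 by (simp add: klein_ratio_def)
    then have gt: "-1 < klein_ratio s d c"
      by simp
    have "artanh (klein_ratio s d c) \<le> artanh (klein_ratio s d t)
        \<or> artanh (klein_ratio s d c) \<le> artanh (klein_ratio s d (d / 2))"
    proof (cases "d \<le> c")
      case True
      then have "klein_ratio s d c \<le> klein_ratio s d t"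
        using klein_ratio_mono s d c(2) by blast
      then show ?thesis
        using artanh_mono[OF gt] artanh_klein_ratio_diameter(1)[OF t d d2t] by (simp add: s_def)
    next
      case False
      then have "klein_ratio s d c \<le> klein_ratio s d (d / 2)"
        using klein_ratio_antimono[of s "d / 2" c d] s d c(1) by simp
      then show ?thesis
        using artanh_mono[OF gt] artanh_klein_ratio_symmetric(1)[OF s d] by simp
    qed
    then show ?thesis
      using lower h by auto
  qed
  then show ?thesis
    using artanh_minimum[OF s d] artanh_klein_ratio_diameter(2)[OF t d d2t]
      artanh_klein_ratio_symmetric(2)[OF s d]
    by (simp add: s_def d_def add_diff_eq)
qed

end
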